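(* Let $\ell(x)=x(1-x)$ and $r(x)=\frac12\left(-1+\sqrt{1+4x}\right)$. Define the polynomials $$P_1(X)=X,\qquad P_2(X)=X^2+X+\tfrac12,\qquad P_3(X)=X^3+\tfrac52X^2+\tfrac52X+\tfrac56,$$ $$P_4(X)=X^4+\tfrac{13}{3}X^3+\tfrac{15}{2}X^2+\tfrac{35}{6}X+\tfrac{61}{36},$$ $$P_5(X)=X^5+\tfrac{77}{12}X^4+\tfrac{101}{6}X^3+\tfrac{265}{12}X^2+\tfrac{515}{36}X+\tfrac{2609}{720},$$ $$P_6(X)=X^6+\tfrac{87}{10}X^5+\tfrac{95}{3}X^4+61X^3+65X^2+\tfrac{12977}{360}X+\tfrac{29069}{3600},$$ and $R_m(X)=(-1)^mP_m(-X)$ for $1\le m\le 6$ (so that $P_m$ and $R_m$ have the same coefficients up to sign, those of $P_m$ being positive and those of $R_m$ alternating in sign). (i) Let $\varepsilon>0$ be such that $\ell(x)\neq0$ and $\ell(x)\neq x$ for all $0<x<\varepsilon$, let $0<x_0<\varepsilon$, and let $x_n=\ell(x_{n-1})$ for $n\ge1$. Then there is a real constant $C$, depending on $x_0$, such that as $n\to\infty$ $$x_n=\frac1n\left\{1+\sum_{m=1}^{6}P_m\bigl(-\ln(n)-C\bigr)\frac1{n^m}\right\}+o\left(\frac{1}{n^{7}}\right).$$ (ii) Let $\varepsilon>0$ be such that $r(x)\neq0$ and $r(x)\neq x$ for all $0<x<\varepsilon$, let $0<x_0<\varepsilon$, and let $x_n=r(x_{n-1})$ for $n\ge1$. Then there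 is a real constant $C$, depending on $x_0$, such that as $n\to\infty$ $$x_n=\frac1n\left\{1+\sum_{m=1}^{6}R_m\bigl(\ln(n)+C\bigr)\frac1{n^m}\right\}+o\left(\frac{1}{n^{7}}\right).$$
   Context: Here $\ln$ is the natural logarithm and $n$ ranges over positive integers. The constants $C$ in (i) and (ii) are unrelated. The expansions are asymptotic expansions in the scale $\ln(n)^j/n^{k}$, truncated after all terms with denominator $n^7$; the $o(n^{-7})$ remainder expresses this. The fact that the two expansions have the same coefficients up to sign is what the paper means by calling $\ell$ and $r$ "kindred" functions. *)

theory Defs
  imports
    "HOL-Analysis.Analysis"
    "HOL-Computational_Algebra.Polynomial"
    "HOL-Library.Landau_Symbols"
begin

definition ell_map :: "real \<Rightarrow> real" where
  "ell_map x = x * (1 - x)"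

definition r_map :: "real \<Rightarrow> real" where
  "r_map x = 1 / 2 * (- 1 + sqrt (1 + 4 * x))"

text \<open>Coefficients are listed from the constant term upwards. Only the indices 1 to 6 are
  meaningful.\<close>

definition P_poly :: "nat \<Rightarrow> real poly" where
  "P_poly m =
    (if m = 1 then [:0, 1:]
     else if m = 2 then [:1/2, 1, 1:]
     else if m = 3 then [:5/6, 5/2, 5/2, 1:]
     else if m = 4 then [:61/36, 35/6, 15/2, 13/3, 1:]
     else if m = 5 then [:2609/720, 515/36, 265/12, 101/6, 77/12, 1:]
     else if m = 6 then [:29069/3600, 12977/360, 65, 61, 95/3, 87/10, 1:]
     else 0)"

definition R_poly :: "nat \<Rightarrow> real poly" where
  "R_poly m = smult ((- 1) ^ m) (pcompose (P_poly m) [:0, - 1:])"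

lemma coeff_R_poly: "coeff (R_poly m) i = (- 1) ^ (m + i) * coeff (P_poly m) i"
  by (simp add: R_poly_def coeff_pcompose_linear power_add)

end

theory Submission
  imports Defs "HOL-Real_Asymp.Real_Asymp"
begin

text \<open>
  Both recursions are instances of one. If \<open>x = r_map y\<close> then \<open>x + x\<^sup>2 = y\<close>, that is,
  \<open>ell_map (- x) = - y\<close>: up to the sign change \<open>z = - x\<close>, the map \<open>r_map\<close> is the inverse of
  \<open>ell_map\<close>. Hence for \<open>\<sigma> = 1\<close> (orbits \<open>x\<close> of \<open>ell_map\<close>) and \<open>\<sigma> = - 1\<close> (orbits \<open>x\<close> of \<open>r_map\<close>)
  the sequence \<open>z = \<sigma> x\<close> moves by one step of \<open>ell_map\<close>, forwards or backwards. This is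
  why the two expansions have the same coefficients up to sign.

  An approximate solution of Abel's equation linearises the dynamics: the function
  \<open>abel z = 1/z + ln \<bar>z\<bar> + z/2 + z\<^sup>2/3 + \<dots>\<close>, with five polynomial terms, satisfies
  \<open>abel (ell_map z) = abel z + 1 + O(z^7)\<close> as \<open>z\<close> tends to 0 from either side
  (\<open>abel_ell_map\<close>). Along an orbit, where \<open>z = O(1/n)\<close>, the errors are summable, and
  \<open>abel (z n) = \<sigma> n + C + o(n^-5)\<close> for some constant \<open>C\<close> (\<open>asymptotic_increment\<close>).

  It remains to invert \<open>abel\<close>. Write \<open>v = \<sigma>/n\<close> and \<open>L = - ln n - C\<close>. The claimed expansion
  \<open>w = v (1 + S)\<close>, where \<open>S\<close> is the sum of the terms \<open>P_m(L) v^m\<close>, satisfies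
  \<open>v (abel w - \<sigma> n - C) = (1/(1+S) - 1) + v (L + ln (1+S) + \<dots>)\<close>. After Taylor expansion in
  \<open>S\<close> this is a polynomial in \<open>v\<close> and \<open>L\<close>, and the coefficients of the \<open>P_m\<close> are exactly such
  that it is divisible by \<open>v^7\<close> (\<open>residual_divisible\<close>). As powers of \<open>ln n\<close> are negligible
  against powers of \<open>n\<close>, also \<open>abel w = \<sigma> n + C + o(n^-5)\<close> (\<open>abel_ansatz\<close>). Finally
  \<open>abel\<close> has derivative of size \<open>1/z\<^sup>2\<close>, so at distance \<open>1/n\<close> from 0 its inverse
  contracts by a factor of order \<open>n^-2\<close> (\<open>abel_expanding\<close>), which yields
  \<open>z - w = o(n^-7)\<close> (\<open>orbit_expansion\<close>).
\<close>

section \<open>An approximate solution of Abel's equation\<close>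

text \<open>These coefficients are determined one after the other by the requirement that the terms of
  order 2 to 6 in \<open>abel_ell_map\<close> vanish.\<close>

definition abel_tail :: "real poly" where
  "abel_tail = [:0, 1/2, 1/3, 13/36, 113/240, 1187/1800:]"

text \<open>On negative reals \<open>ln\<close> takes the value \<open>ln \<bar>z\<bar>\<close>, so that this definition serves both sides
  of 0.\<close>

definition abel :: "real \<Rightarrow> real" where
  "abel z = 1 / z + ln z + poly abel_tail z"

lemma abel_ell_map: "(\<lambda>z. abel (ell_map z) - abel z - 1) \<in> O[at 0](\<lambda>z. z ^ 7)"
proof -
  have "\<forall>\<^sub>F z in at 0. abel (ell_map z) - abel z - 1 =
      1 / (1 - z) + ln (1 - z) - 1 + poly abel_tail (z * (1 - z)) - poly abel_tail z"
  proof -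
    have "\<forall>\<^sub>F z in at 0. z \<noteq> 0 \<and> z < (1::real)"
      by (intro eventually_conj eventually_neq_at_within order_tendstoD(2)[OF tendsto_ident_at]) auto
    then show ?thesis
    proof eventually_elim
      case (elim z)
      then have "1 / (z * (1 - z)) - 1 / z = 1 / (1 - z)"
        by (simp add: field_simps)
      then show ?case
        using elim by (simp add: abel_def ell_map_def ln_mult)
    qed
  qed
  moreover have "(\<lambda>z. 1 / (1 - z) + ln (1 - z) - 1 + poly abel_tail (z * (1 - z)) - poly abel_tail z)
      \<in> O[at 0](\<lambda>z. z ^ 7)"
    unfolding abel_tail_def poly_pCons poly_0
    by real_asymp
  ultimately show ?thesis
    by (rule landau_o.big.in_cong[THEN iffD2])
qed

text \<open>The derivative of \<open>abel\<close> at \<open>z\<close> is asymptotic to \<open>- 1/z\<^sup>2\<close>, hence at least \<open>1/(2 M\<^sup>2)\<close> in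
  absolute value when \<open>\<bar>z\<bar> \<le> M\<close> is small. The sign condition keeps the pole at 0 out of the
  segment from \<open>a\<close> to \<open>b\<close>.\<close>

lemma abel_expanding:
  obtains \<delta> where "\<delta> > 0"
    "\<And>a b M. a * b > 0 \<Longrightarrow> \<bar>a\<bar> \<le> M \<Longrightarrow> \<bar>b\<bar> \<le> M \<Longrightarrow> M < \<delta> \<Longrightarrow> \<bar>a - b\<bar> \<le> 2 * M\<^sup>2 * \<bar>abel a - abel b\<bar>"
proof -
  define d where "d z = - 1 / z\<^sup>2 + 1 / z + poly (pderiv abel_tail) z" for z
  have deriv: "(abel has_real_derivative d z) (at z)" if "z \<noteq> 0" for z
  proof -
    have "(ln has_real_derivative 1 / z) (at z)"
    proof (cases "z > 0")
      case False
      with that have "((\<lambda>y. ln (- y)) has_real_derivative 1 / z) (at z)"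
        by (auto intro!: derivative_eq_intros)
      then show ?thesis
        by (simp add: ln_minus)
    qed (rule DERIV_ln_divide)
    moreover have "((\<lambda>y. 1 / y) has_real_derivative - 1 / z\<^sup>2) (at z)"
      using that by (auto intro!: derivative_eq_intros simp: power2_eq_square)
    ultimately show ?thesis
      unfolding abel_def[abs_def] d_def by (intro DERIV_add poly_DERIV)
  qed
  have "((\<lambda>z. z\<^sup>2 * d z) \<longlongrightarrow> - 1) (at 0)"
  proof -
    have "((\<lambda>z. - 1 + z + z\<^sup>2 * poly (pderiv abel_tail) z) \<longlongrightarrow> - 1 + 0 + 0\<^sup>2 * poly (pderiv abel_tail) 0) (at 0)"
      by (intro tendsto_intros)
    moreover have "\<forall>\<^sub>F z in at 0. - 1 + z + z\<^sup>2 * poly (pderiv abel_tail) z = z\<^sup>2 * d z"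
      using eventually_neq_at_within[of 0]
      by eventually_elim (simp add: d_def field_simps power2_eq_square)
    ultimately show ?thesis
      using Lim_transform_eventually by force
  qed
  then have "\<forall>\<^sub>F z in at 0. z\<^sup>2 * d z < - 1 / 2"
    by (rule order_tendstoD) simp
  then obtain \<delta> where \<delta>: "\<delta> > 0" "\<And>z. z \<noteq> 0 \<Longrightarrow> \<bar>z\<bar> < \<delta> \<Longrightarrow> z\<^sup>2 * d z < - 1 / 2"
    unfolding eventually_at by (auto simp: dist_real_def)
  have *: "\<bar>a - b\<bar> \<le> 2 * M\<^sup>2 * \<bar>abel a - abel b\<bar>"
    if "a < b" "a * b > 0" "\<bar>a\<bar> \<le> M" "\<bar>b\<bar> \<le> M" "M < \<delta>" for a b M
  proof -
    have nz: "t \<noteq> 0" if "a \<le> t" "t \<le> b" for t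
      using that \<open>a * b > 0\<close> by (auto simp: zero_less_mult_iff)
    then obtain t where t: "a < t" "t < b" "abel b - abel a = (b - a) * d t"
      using MVT2[OF \<open>a < b\<close>, of abel d] deriv by blast
    from t that have "\<bar>t\<bar> \<le> M"
      by auto
    then have "t\<^sup>2 \<le> M\<^sup>2"
      by (simp add: abs_le_square_iff[symmetric])
    have "t\<^sup>2 * d t < - 1 / 2"
      using \<delta>(2)[of t] nz[of t] t \<open>\<bar>t\<bar> \<le> M\<close> \<open>M < \<delta>\<close> by simp
    then have "1 / 2 \<le> \<bar>t\<^sup>2 * d t\<bar>"
      by linarith
    then have "1 \<le> 2 * t\<^sup>2 * \<bar>d t\<bar>"
      by (simp add: abs_mult)
    also have "\<dots> \<le> 2 * M\<^sup>2 * \<bar>d t\<bar>"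
      using \<open>t\<^sup>2 \<le> M\<^sup>2\<close> by (simp add: mult_right_mono)
    finally have "\<bar>b - a\<bar> * 1 \<le> \<bar>b - a\<bar> * (2 * M\<^sup>2 * \<bar>d t\<bar>)"
      by (rule mult_left_mono) simp
    also have "\<dots> = 2 * M\<^sup>2 * \<bar>abel b - abel a\<bar>"
      by (simp add: t(3) abs_mult)
    finally show ?thesis
      by (simp add: abs_minus_commute)
  qed
  have "\<bar>a - b\<bar> \<le> 2 * M\<^sup>2 * \<bar>abel a - abel b\<bar>"
    if "a * b > 0" "\<bar>a\<bar> \<le> M" "\<bar>b\<bar> \<le> M" "M < \<delta>" for a b M
    using *[of a b M] *[of b a M] that
    by (cases a b rule: linorder_cases) (auto simp: abs_minus_commute mult.commute)
  with \<delta>(1) show thesis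
    by (rule that)
qed

section \<open>Sequences with almost constant increments\<close>

text \<open>After weighting with \<open>n^5\<close> the errors in the increments are still summable, because they are
  \<open>O(n^-2)\<close>. The distance from \<open>b n - s n\<close> to its limit is a tail of the unweighted series, and
  there the weight \<open>n^5\<close> can be moved inside since it is increasing.\<close>

lemma asymptotic_increment:
  fixes b :: "nat \<Rightarrow> real"
  assumes "(\<lambda>n. b (Suc n) - b n - s) \<in> O(\<lambda>n. 1 / real n ^ 7)"
  obtains C where "(\<lambda>n. b n - s * real n - C) \<in> o(\<lambda>n. 1 / real n ^ 5)"
proof -
  define d where "d n = b (Suc n) - b n - s" for n
  have d: "d \<in> O(\<lambda>n. 1 / real n ^ 7)"
    using assms by (simp add: d_def[abs_def])
  have sq: "summable (\<lambda>n. 1 / real n ^ 2)"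
    using inverse_power_summable[of 2, where 'a = real] by (simp add: field_simps)
  have "(\<lambda>n. real n ^ 5 * d n) \<in> O(\<lambda>n. real n ^ 5 * (1 / real n ^ 7))"
    by (intro landau_o.big.mult d) simp
  also have "(\<lambda>n. real n ^ 5 * (1 / real n ^ 7)) \<in> O(\<lambda>n. 1 / real n ^ 2)"
    by real_asymp
  finally have "(\<lambda>n. norm (real n ^ 5 * d n)) \<in> O(\<lambda>n. 1 / real n ^ 2)"
    by simp
  then have e: "summable (\<lambda>n. real n ^ 5 * \<bar>d n\<bar>)"
    using summable_comparison_test_bigo[of "\<lambda>n. 1 / real n ^ 2" "\<lambda>n. norm (real n ^ 5 * d n)"] sq
    by (simp add: abs_mult)
  have sd: "summable (\<lambda>n. \<bar>d n\<bar>)"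
  proof (rule summable_comparison_test_ev[OF _ e])
    show "\<forall>\<^sub>F n in sequentially. norm \<bar>d n\<bar> \<le> real n ^ 5 * \<bar>d n\<bar>"
      using eventually_ge_at_top[of 1]
    proof eventually_elim
      case (elim n)
      then have "1 * \<bar>d n\<bar> \<le> real n ^ 5 * \<bar>d n\<bar>"
        by (intro mult_right_mono) auto
      then show ?case by simp
    qed
  qed
  have partial: "b n - s * real n = b 0 + (\<Sum>k<n. d k)" for n
    by (induction n) (auto simp: d_def algebra_simps)
  define C where "C = b 0 + suminf d"
  have eq: "b n - s * real n - C = - (\<Sum>k. d (k + n))" for n
    using suminf_split_initial_segment[of d n] summable_rabs_cancel[OF sd] by (simp add: partial C_def)
  have tail: "real n ^ 5 * \<bar>b n - s * real n - C\<bar> \<le> (\<Sum>k. real (k + n) ^ 5 * \<bar>d (k + n)\<bar>)" for n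
  proof -
    have sdn: "summable (\<lambda>k. \<bar>d (k + n)\<bar>)" and en: "summable (\<lambda>k. real (k + n) ^ 5 * \<bar>d (k + n)\<bar>)"
      using summable_ignore_initial_segment[OF sd, of n] summable_ignore_initial_segment[OF e, of n]
      by auto
    have "real n ^ 5 * \<bar>b n - s * real n - C\<bar> \<le> real n ^ 5 * (\<Sum>k. \<bar>d (k + n)\<bar>)"
      unfolding eq using summable_rabs[OF sdn] by (intro mult_left_mono) auto
    also have "\<dots> = (\<Sum>k. real n ^ 5 * \<bar>d (k + n)\<bar>)"
      by (rule suminf_mult[OF sdn, symmetric])
    also have "\<dots> \<le> (\<Sum>k. real (k + n) ^ 5 * \<bar>d (k + n)\<bar>)"
      by (intro suminf_le summable_mult sdn en mult_right_mono power_mono) auto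
    finally show ?thesis .
  qed
  have "(\<lambda>n. b n - s * real n - C) \<in> o(\<lambda>n. 1 / real n ^ 5)"
  proof (rule landau_o.smallI)
    fix c :: real assume "c > 0"
    then obtain N where N: "\<And>n. n \<ge> N \<Longrightarrow> norm (\<Sum>k. real (k + n) ^ 5 * \<bar>d (k + n)\<bar>) < c"
      using suminf_exist_split[OF _ e] by blast
    show "\<forall>\<^sub>F n in sequentially. norm (b n - s * real n - C) \<le> c * norm (1 / real n ^ 5)"
      using eventually_ge_at_top[of N] eventually_gt_at_top[of 0]
    proof eventually_elim
      case (elim n)
      then have "real n ^ 5 * \<bar>b n - s * real n - C\<bar> \<le> c"
        using tail[of n] N[of n] by simp
      with elim show ?case
        by (simp add: field_simps)
    qed
  qed
  then show thesis
    by (rule that)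
qed



section \<open>The formal identity behind the coefficients\<close>

text \<open>A polynomial in \<open>v\<close> and \<open>L\<close> is represented as a polynomial in \<open>v\<close> whose coefficients are
  polynomials in \<open>L\<close>. Only the coefficients up to \<open>v^6\<close> matter for the residual below, and
  its products have many terms of higher order. The operation \<open>trunc_mult\<close> and
  the rules for it make rewriting discard high powers of \<open>v\<close> early.\<close>

definition trunc_mult :: "nat \<Rightarrow> 'a :: comm_ring_1 poly \<Rightarrow> 'a poly \<Rightarrow> 'a poly" where
  "trunc_mult n p q = poly_cutoff n (p * q)"

lemma poly_cutoff_0_left: "poly_cutoff 0 p = 0"
  by (simp add: poly_eq_iff coeff_poly_cutoff)

lemma poly_cutoff_Suc: "poly_cutoff (Suc n) (pCons a p) = pCons a (poly_cutoff n p)"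
  by (auto simp: poly_eq_iff coeff_poly_cutoff coeff_pCons split: nat.split)

lemma poly_cutoff_add: "poly_cutoff n (p + q) = poly_cutoff n p + poly_cutoff n q"
  by (simp add: poly_eq_iff coeff_poly_cutoff)

lemma poly_cutoff_smult: "poly_cutoff n (smult a p) = smult a (poly_cutoff n p)"
  by (simp add: poly_eq_iff coeff_poly_cutoff)

lemma poly_cutoff_mult: "poly_cutoff n (p * q) = trunc_mult n p (poly_cutoff n q)"
  by (auto simp: poly_eq_iff coeff_poly_cutoff trunc_mult_def coeff_mult intro!: sum.cong)

lemma trunc_mult_0: "trunc_mult 0 p q = 0" "trunc_mult n 0 q = 0"
  by (simp_all add: trunc_mult_def poly_cutoff_0_left)

lemma trunc_mult_Suc:
  "trunc_mult (Suc n) (pCons a p) q =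
     smult a (poly_cutoff (Suc n) q) + pCons 0 (trunc_mult n p (poly_cutoff n q))"
  by (simp add: trunc_mult_def poly_cutoff_add poly_cutoff_smult poly_cutoff_Suc
      flip: poly_cutoff_mult[unfolded trunc_mult_def])

text \<open>A step of Horner's scheme in a polynomial without constant term needs one order less in the
  inner factor. Applied from the outside, these rules truncate every product before it is
  multiplied out.\<close>

lemma poly_cutoff_shift_mult:
  "poly_cutoff (Suc n) (pCons 0 p * q) = pCons 0 (trunc_mult n p (poly_cutoff n q))"
  "poly_cutoff (Suc n) ([:a:] + pCons 0 p * q) = pCons a (trunc_mult n p (poly_cutoff n q))"
  by (simp_all add: poly_cutoff_Suc poly_cutoff_mult)

text \<open>The correction \<open>S = P_1 v + \<dots> + P_6 v^6\<close> of the ansatz \<open>w = v (1 + S)\<close>, divided by \<open>v\<close>; the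
  correction itself is \<open>pCons 0 corr_quot\<close>.\<close>

definition corr_quot :: "real poly poly" where
  "corr_quot = [:P_poly 1, P_poly 2, P_poly 3, P_poly 4, P_poly 5, P_poly 6:]"

text \<open>The defect \<open>v (abel w - 1/v - C)\<close> of the ansatz, with Taylor polynomials in place of
  \<open>1/(1+S)\<close> and \<open>ln (1+S)\<close>, written in Horner form to suit \<open>poly_cutoff_shift_mult\<close>. The summand
  before \<open>pCons 0\<close> comes from \<open>1/(1+S) - 1\<close>; inside, \<open>L\<close> and the terms in \<open>S\<close> come from
  \<open>L + ln (1+S)\<close>, and those in \<open>W = v (1+S)\<close> from the polynomial \<open>abel_tail\<close>. The expanded form is in \<open>eval2_residual\<close>.\<close>

definition residual :: "real poly poly" where
  "residual =
    (let S = pCons 0 corr_quot; W = pCons 0 (pCons 1 corr_quot) in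
     S * ([:-1:] + S * ([:1:] + S * ([:-1:] + S * ([:1:] + S * ([:-1:] + S * [:1:])))))
     + pCons 0 ([:[:0, 1:]:]
       + S * ([:1:] + S * ([:[:-1/2:]:] + S * ([:[:1/3:]:] + S * ([:[:-1/4:]:] + S * [:[:1/5:]:]))))
       + W * ([:[:1/2:]:] + W * ([:[:1/3:]:] + W * ([:[:13/36:]:] + W * ([:[:113/240:]:]
           + W * [:[:1187/1800:]:]))))))"

text \<open>This is the computation that singles out the polynomials \<open>P_m\<close>: the coefficient of \<open>v^m\<close> is
  \<open>- P_m\<close> plus terms in \<open>L\<close> and \<open>P_1, \<dots>, P_(m-1)\<close>.\<close>

lemma residual_divisible: "monom 1 7 dvd residual"
proof -
  \<comment> \<open>The first pass distributes the truncation while \<open>corr_quot\<close> is still folded; only then the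
    coefficients are inserted. The order is unary so that the recursive rules apply.\<close>
  have "poly_cutoff (Suc (Suc (Suc (Suc (Suc (Suc (Suc 0))))))) residual = 0"
    unfolding residual_def Let_def
    by (simp only: poly_cutoff_shift_mult poly_cutoff_add poly_cutoff_Suc poly_cutoff_0_left,
        simp add: corr_quot_def P_poly_def poly_cutoff_0_left poly_cutoff_Suc
          trunc_mult_0 trunc_mult_Suc one_pCons)
  then have "\<forall>k<7. coeff residual k = 0"
    by (auto simp: poly_eq_iff coeff_poly_cutoff split: if_splits)
  then show ?thesis
    by (simp add: monom_1_dvd_iff')
qed

definition eval2 :: "real poly poly \<Rightarrow> real \<Rightarrow> real \<Rightarrow> real" where
  "eval2 G v L = poly (poly G [:v:]) L"

lemma eval2_simps:
  "eval2 0 v L = 0" "eval2 1 v L = 1"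
  "eval2 (pCons p G) v L = poly p L + v * eval2 G v L"
  "eval2 (G + H) v L = eval2 G v L + eval2 H v L"
  "eval2 (G * H) v L = eval2 G v L * eval2 H v L"
  "eval2 (smult p G) v L = poly p L * eval2 G v L"
  by (simp_all add: eval2_def)

lemma eval2_monom: "eval2 (monom 1 n) v L = v ^ n"
  by (simp add: eval2_def poly_monom poly_power)

lemma eval2_residual:
  fixes v L :: real
  defines "s \<equiv> eval2 (pCons 0 corr_quot) v L"
  shows "eval2 residual v L =
    (- s + s ^ 2 - s ^ 3 + s ^ 4 - s ^ 5 + s ^ 6)
    + v * (L + (s - s ^ 2 / 2 + s ^ 3 / 3 - s ^ 4 / 4 + s ^ 5 / 5) + poly abel_tail (v * (1 + s)))"
proof -
  define S where "S = pCons 0 corr_quot"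
  define W where "W = pCons 0 (pCons 1 corr_quot)"
  define w where "w = v * (1 + s)"
  have "eval2 S v L = s" "eval2 W v L = w"
    by (simp_all add: s_def w_def S_def W_def eval2_simps)
  then have "eval2 residual v L = 
     s * (-1 + s * (1 + s * (-1 + s * (1 + s * (-1 + s)))))
     + v * (L + s * (1 + s * (-1/2 + s * (1/3 + s * (-1/4 + s * (1/5))))) + poly abel_tail w)"
    unfolding residual_def Let_def S_def[symmetric] W_def[symmetric]
    by (simp add: eval2_simps abel_tail_def)
  also have "s * (-1 + s * (1 + s * (-1 + s * (1 + s * (-1 + s))))) =
      - s + s ^ 2 - s ^ 3 + s ^ 4 - s ^ 5 + s ^ 6"
    by (simp add: algebra_simps eval_nat_numeral)
  also have "s * (1 + s * (-1/2 + s * (1/3 + s * (-1/4 + s * (1/5))))) =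
      s - s ^ 2 / 2 + s ^ 3 / 3 - s ^ 4 / 4 + s ^ 5 / 5"
    by (simp add: field_simps eval_nat_numeral)
  finally show ?thesis
    by (simp add: w_def)
qed

section \<open>The ansatz in the Abel coordinate\<close>

text \<open>Taylor estimates hold on punctured neighbourhoods; adding the centre makes them
  applicable to null sequences that may take the value 0.\<close>

lemma bigo_nhds_0:
  fixes f g :: "real \<Rightarrow> real"
  assumes "f \<in> O[at 0](g)" "f 0 = 0"
  shows "f \<in> O[nhds 0](g)"
proof -
  obtain c where "c > 0" and c: "\<forall>\<^sub>F x in at 0. norm (f x) \<le> c * norm (g x)"
    using landau_o.bigE[OF assms(1)] by blast
  from c have "\<forall>\<^sub>F x in nhds 0. norm (f x) \<le> c * norm (g x)"
    unfolding eventually_at_filter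
    by (rule eventually_mono) (use assms(2) \<open>c > 0\<close> in force)
  then show ?thesis
    by (rule landau_o.bigI[OF \<open>c > 0\<close>])
qed

lemma poly_ln_bigo:
  assumes "\<delta> > 0"
  shows "(\<lambda>n. poly p (- ln (real n) - C)) \<in> O(\<lambda>n. real n powr \<delta>)"
  using assms
proof (induction p arbitrary: \<delta>)
  case (pCons a p)
  have "(\<lambda>n. - ln (real n) - C) \<in> O(\<lambda>n. real n powr (\<delta> / 2))"
    using \<open>\<delta> > 0\<close> by real_asymp
  moreover have "(\<lambda>n. poly p (- ln (real n) - C)) \<in> O(\<lambda>n. real n powr (\<delta> / 2))"
    using \<open>\<delta> > 0\<close> by (intro pCons.IH) simp
  ultimately have "(\<lambda>n. (- ln (real n) - C) * poly p (- ln (real n) - C))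
      \<in> O(\<lambda>n. real n powr (\<delta> / 2) * real n powr (\<delta> / 2))"
    by (rule landau_o.big.mult)
  also have "(\<lambda>n. real n powr (\<delta> / 2) * real n powr (\<delta> / 2)) = (\<lambda>n. real n powr \<delta>)"
    by (simp flip: powr_add)
  finally have "(\<lambda>n. (- ln (real n) - C) * poly p (- ln (real n) - C)) \<in> O(\<lambda>n. real n powr \<delta>)" .
  moreover have "(\<lambda>n. a) \<in> O(\<lambda>n. real n powr \<delta>)"
    using \<open>\<delta> > 0\<close> by real_asymp
  ultimately show ?case
    by (simp add: sum_in_bigo)
qed simp

lemma eval2_bigo:
  assumes "\<delta> > 0"
  shows "(\<lambda>n. eval2 G (\<sigma> / real n) (- ln (real n) - C)) \<in> O(\<lambda>n. real n powr \<delta>)"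
proof (induction G)
  case (pCons p G)
  have "(\<lambda>n. \<sigma> / real n * eval2 G (\<sigma> / real n) (- ln (real n) - C)) \<in> O(\<lambda>n. 1 * real n powr \<delta>)"
    by (intro landau_o.big.mult pCons.IH) real_asymp
  with poly_ln_bigo[OF assms] show ?case
    by (simp add: eval2_simps sum_in_bigo)
qed (simp add: eval2_simps)

text \<open>Up to \<open>n powr \<delta>\<close> with small \<open>\<delta>\<close>, the correction \<open>s\<close> is of order \<open>1/n\<close>. The defect multiplied by
  \<open>v\<close> has to be \<open>o(n^-6)\<close>, so the Taylor polynomials of degree 6 and 5 in \<open>residual\<close> are long
  enough: the remainders are of order \<open>s^7\<close> and \<open>v s^6\<close>. The exponent \<open>9/10\<close> leaves
  sufficient room, since \<open>7 * 9/10\<close> and \<open>1 + 6 * 9/10\<close> exceed 6.\<close>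

lemma abel_ansatz:
  fixes \<sigma> C :: real
  assumes \<sigma>: "\<sigma> * \<sigma> = 1"
  defines "s \<equiv> \<lambda>n. eval2 (pCons 0 corr_quot) (\<sigma> / real n) (- ln (real n) - C)"
  shows "s \<longlonglongrightarrow> 0"
    and "(\<lambda>n. abel (\<sigma> / real n * (1 + s n)) - \<sigma> * real n - C) \<in> o(\<lambda>n. 1 / real n ^ 5)"
proof -
  define v where "v n = \<sigma> / real n" for n
  define L where "L n = - ln (real n) - C" for n
  have abs\<sigma>: "\<bar>\<sigma>\<bar> = 1"
    using \<sigma> by (metis abs_1 abs_mult abs_mult_self_eq power2_eq_1_iff power2_eq_square abs_minus)
  have v: "v \<in> O(\<lambda>n. 1 / real n)"
    unfolding v_def by real_asymp
  have "(\<lambda>n. v n * eval2 corr_quot (v n) (L n)) \<in> O(\<lambda>n. 1 / real n * real n powr (1 / 10))"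
    using eval2_bigo[of "1 / 10" corr_quot \<sigma> C]
    by (intro landau_o.big.mult v) (simp add: v_def L_def)
  also have "(\<lambda>n. 1 / real n * real n powr (1 / 10)) \<in> O(\<lambda>n. real n powr (- 9 / 10))"
    by real_asymp
  finally have s: "s \<in> O(\<lambda>n. real n powr (- 9 / 10))"
    by (simp add: s_def eval2_simps v_def L_def)
  show s0: "s \<longlonglongrightarrow> 0"
  proof -
    note s
    also have "(\<lambda>n. real n powr (- 9 / 10)) \<in> o(\<lambda>n. 1)"
      by real_asymp
    finally show ?thesis
      using smalloD_tendsto by force
  qed
  have taylor: "(\<lambda>n. f (s n)) \<in> O(\<lambda>n. real n powr (- 9 / 10 * real k))"
    if f: "f \<in> O[at 0](\<lambda>t. t ^ k)" "f 0 = 0" for f :: "real \<Rightarrow> real" and k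
  proof -
    have "(\<lambda>n. f (s n)) \<in> O(\<lambda>n. s n ^ k)"
      by (rule landau_o.big.compose[OF bigo_nhds_0[OF f] s0])
    also have "(\<lambda>n. s n ^ k) \<in> O(\<lambda>n. (real n powr (- 9 / 10)) ^ k)"
      by (rule landau_o.big_power[OF s])
    also have "(\<lambda>n. (real n powr (- 9 / 10)) ^ k) \<in> O(\<lambda>n. real n powr (- 9 / 10 * real k))"
      by (rule bigoI[of _ 1], rule eventually_mono[OF eventually_gt_at_top[of 0]])
        (simp add: powr_power mult.commute)
    finally show ?thesis .
  qed
  \<comment> \<open>Taylor remainders of \<open>1/(1+t)\<close> and \<open>ln (1+t)\<close>\<close>
  define r1 where "r1 t = 1 / (1 + t) - (1 - t + t ^ 2 - t ^ 3 + t ^ 4 - t ^ 5 + t ^ 6)" for t :: real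
  define r2 where "r2 t = ln (1 + t) - (t - t ^ 2 / 2 + t ^ 3 / 3 - t ^ 4 / 4 + t ^ 5 / 5)" for t :: real
  have r1: "(\<lambda>n. r1 (s n)) \<in> o(\<lambda>n. 1 / real n ^ 6)"
  proof -
    have "(\<lambda>n. r1 (s n)) \<in> O(\<lambda>n. real n powr (- 9 / 10 * real 7))"
      by (rule taylor) (unfold r1_def, real_asymp, simp)
    also have "(\<lambda>n. real n powr (- 9 / 10 * real 7)) \<in> o(\<lambda>n. 1 / real n ^ 6)"
      by simp real_asymp
    finally show ?thesis .
  qed
  have r2: "(\<lambda>n. v n * r2 (s n)) \<in> o(\<lambda>n. 1 / real n ^ 6)"
  proof -
    have "(\<lambda>n. r2 (s n)) \<in> O(\<lambda>n. real n powr (- 9 / 10 * real 6))"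
      by (rule taylor) (unfold r2_def, real_asymp, simp)
    then have "(\<lambda>n. v n * r2 (s n)) \<in> O(\<lambda>n. 1 / real n * real n powr (- 9 / 10 * real 6))"
      by (intro landau_o.big.mult v)
    also have "(\<lambda>n. 1 / real n * real n powr (- 9 / 10 * real 6)) \<in> o(\<lambda>n. 1 / real n ^ 6)"
      by simp real_asymp
    finally show ?thesis .
  qed
  have r3: "(\<lambda>n. eval2 residual (v n) (L n)) \<in> o(\<lambda>n. 1 / real n ^ 6)"
  proof -
    obtain G where G: "residual = monom 1 7 * G"
      using residual_divisible by (auto simp: dvd_def)
    have "(\<lambda>n. v n ^ 7 * eval2 G (v n) (L n)) \<in> O(\<lambda>n. (1 / real n) ^ 7 * real n powr (1 / 2))"
      using eval2_bigo[of "1 / 2" G \<sigma> C]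
      by (intro landau_o.big.mult landau_o.big_power v) (simp add: v_def L_def)
    also have "(\<lambda>n. (1 / real n) ^ 7 * real n powr (1 / 2)) \<in> o(\<lambda>n. 1 / real n ^ 6)"
      by real_asymp
    finally show ?thesis
      by (simp add: G eval2_simps eval2_monom)
  qed
  have "(\<lambda>n. \<sigma> * real n * (r1 (s n) + v n * r2 (s n) + eval2 residual (v n) (L n)))
      \<in> o(\<lambda>n. real n * (1 / real n ^ 6))"
    by (rule landau_o.big_small_mult) (real_asymp, intro sum_in_smallo r1 r2 r3)
  also have "(\<lambda>n. real n * (1 / real n ^ 6)) \<in> O(\<lambda>n. 1 / real n ^ 5)"
    by real_asymp
  finally have small: "(\<lambda>n. \<sigma> * real n * (r1 (s n) + v n * r2 (s n) + eval2 residual (v n) (L n)))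
      \<in> o(\<lambda>n. 1 / real n ^ 5)" .
  have "\<forall>\<^sub>F n in sequentially.
      \<sigma> * real n * (r1 (s n) + v n * r2 (s n) + eval2 residual (v n) (L n)) =
      abel (\<sigma> / real n * (1 + s n)) - \<sigma> * real n - C"
    using eventually_gt_at_top[of 0] order_tendstoD(1)[OF s0, of "-1", simplified]
  proof eventually_elim
    case (elim n)
    have \<sigma>0: "\<sigma> \<noteq> 0" "1 / \<sigma> = \<sigma>"
      using \<sigma> by (auto simp: divide_eq_eq)
    have vn: "\<sigma> * real n * v n = 1"
      using elim \<sigma> by (simp add: v_def field_simps)
    have "ln \<sigma> = 0"
      using abs\<sigma> by (auto simp: abs_if ln_minus[of 1, simplified] split: if_splits)
    then have "ln (v n * (1 + s n)) = - ln (real n) + ln (1 + s n)"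
      using elim \<sigma>0 by (simp add: v_def ln_mult divide_inverse ln_inverse)
    moreover have "1 / (v n * (1 + s n)) = \<sigma> * real n / (1 + s n)"
    proof -
      have "1 / v n = real n * (1 / \<sigma>)"
        by (simp add: v_def)
      then have "1 / v n = \<sigma> * real n"
        unfolding \<sigma>0(2) by simp
      then show ?thesis
        by (metis divide_divide_eq_left)
    qed
    ultimately have "abel (v n * (1 + s n)) - \<sigma> * real n - C =
        \<sigma> * real n * (1 / (1 + s n) - 1)
          + 1 * (ln (1 + s n) + L n + poly abel_tail (v n * (1 + s n)))"
      by (simp add: abel_def L_def algebra_simps)
    also have "\<dots> = \<sigma> * real n * (1 / (1 + s n) - 1
          + v n * (ln (1 + s n) + L n + poly abel_tail (v n * (1 + s n))))"
      unfolding vn[symmetric] by (simp add: algebra_simps)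
    also have "1 / (1 + s n) - 1 + v n * (ln (1 + s n) + L n + poly abel_tail (v n * (1 + s n))) =
        r1 (s n) + v n * r2 (s n) + eval2 residual (v n) (L n)"
      unfolding eval2_residual r1_def r2_def
      by (simp add: s_def[folded v_def L_def] algebra_simps)
    finally show ?case
      by (simp add: v_def)
  qed
  from landau_o.small.in_cong[OF this] small
  show "(\<lambda>n. abel (\<sigma> / real n * (1 + s n)) - \<sigma> * real n - C) \<in> o(\<lambda>n. 1 / real n ^ 5)"
    by (rule iffD1)
qed


section \<open>Expansion of the orbits\<close>

lemma eval2_corr:
  "eval2 (pCons 0 corr_quot) v L = (\<Sum>m=1..6. poly (P_poly m) L * v ^ m)"
proof -
  have "{1..6} = {1, 2, 3, 4, 5, 6 :: nat}"
    by auto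
  then show ?thesis
    by (simp add: eval2_simps corr_quot_def algebra_simps eval_nat_numeral)
qed

text \<open>The orbit and the ansatz have \<open>abel\<close>-coordinates that differ by \<open>o(n^-5)\<close> and both are
  \<open>O(1/n)\<close> of sign \<open>\<sigma>\<close>; so \<open>abel_expanding\<close> with \<open>M = K/n\<close> gains a factor \<open>n^-2\<close>. A crude bound
  \<open>O(1/n)\<close> on the orbit suffices: the precise behaviour \<open>z n \<sim> \<sigma>/n\<close> is part of the conclusion.\<close>

lemma orbit_expansion:
  fixes z :: "nat \<Rightarrow> real"
  assumes \<sigma>: "\<sigma> * \<sigma> = 1"
    and sign: "\<And>n. \<sigma> * z n > 0"
    and z: "z \<in> O(\<lambda>n. 1 / real n)"
    and step: "(\<lambda>n. abel (z (Suc n)) - abel (z n) - \<sigma>) \<in> O(\<lambda>n. 1 / real n ^ 7)"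
  obtains C where "(\<lambda>n. z n - \<sigma> / real n *
      (1 + (\<Sum>m=1..6. poly (P_poly m) (- ln (real n) - C) * (\<sigma> / real n) ^ m))) \<in> o(\<lambda>n. 1 / real n ^ 7)"
proof -
  obtain C where C: "(\<lambda>n. abel (z n) - \<sigma> * real n - C) \<in> o(\<lambda>n. 1 / real n ^ 5)"
    using asymptotic_increment[OF step] by blast
  define s where "s n = eval2 (pCons 0 corr_quot) (\<sigma> / real n) (- ln (real n) - C)" for n
  define w where "w n = \<sigma> / real n * (1 + s n)" for n
  have s0: "s \<longlonglongrightarrow> 0"
    unfolding s_def by (rule abel_ansatz(1)[OF \<sigma>])
  have "(\<lambda>n. abel (w n) - \<sigma> * real n - C) \<in> o(\<lambda>n. 1 / real n ^ 5)"
    unfolding w_def s_def by (rule abel_ansatz(2)[OF \<sigma>])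
  from sum_in_smallo(2)[OF C this]
  have diff: "(\<lambda>n. abel (z n) - abel (w n)) \<in> o(\<lambda>n. 1 / real n ^ 5)"
    by simp
  have "(\<lambda>n. \<sigma> / real n * (1 + s n)) \<in> O(\<lambda>n. 1 / real n * 1)"
  proof (rule landau_o.big.mult)
    show "(\<lambda>n. 1 + s n) \<in> O(\<lambda>n. 1)"
      using tendsto_add[OF tendsto_const[of 1] s0] by (intro bigoI_tendsto[of _ _ 1]) simp_all
  qed real_asymp
  then have w: "w \<in> O(\<lambda>n. 1 / real n)"
    by (simp add: w_def[abs_def])
  obtain K1 where "K1 > 0" and K1: "\<forall>\<^sub>F n in sequentially. norm (z n) \<le> K1 * norm (1 / real n)"
    using landau_o.bigE[OF z] by blast
  obtain K2 where "K2 > 0" and K2: "\<forall>\<^sub>F n in sequentially. norm (w n) \<le> K2 * norm (1 / real n)"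
    using landau_o.bigE[OF w] by blast
  define K where "K = max K1 K2"
  have "K > 0"
    using \<open>K1 > 0\<close> by (simp add: K_def)
  obtain \<delta> where "\<delta> > 0" and \<delta>: "\<And>a b M. a * b > 0 \<Longrightarrow> \<bar>a\<bar> \<le> M \<Longrightarrow> \<bar>b\<bar> \<le> M \<Longrightarrow> M < \<delta>
      \<Longrightarrow> \<bar>a - b\<bar> \<le> 2 * M\<^sup>2 * \<bar>abel a - abel b\<bar>"
    using abel_expanding by blast
  have "(\<lambda>n. K / real n) \<longlonglongrightarrow> 0"
    by real_asymp
  then have "\<forall>\<^sub>F n in sequentially. K / real n < \<delta>"
    using \<open>\<delta> > 0\<close> by (rule order_tendstoD)
  then have bound: "\<forall>\<^sub>F n in sequentially.
      \<bar>z n - w n\<bar> \<le> 1 * norm (2 * (K / real n)\<^sup>2 * (abel (z n) - abel (w n)))"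
    using K1 K2 order_tendstoD(1)[OF s0, of "-1", simplified] eventually_gt_at_top[of 0]
  proof eventually_elim
    case (elim n)
    have "\<bar>z n\<bar> \<le> K / real n" "\<bar>w n\<bar> \<le> K / real n"
      using elim by (auto simp: K_def field_simps max_def split: if_splits elim: order_trans)
    moreover have "z n * w n > 0"
    proof -
      have "(\<sigma> * z n) * ((1 + s n) / real n) > 0"
        using elim by (intro mult_pos_pos sign) auto
      then show ?thesis
        by (simp add: w_def mult_ac)
    qed
    ultimately have "\<bar>z n - w n\<bar> \<le> 2 * (K / real n)\<^sup>2 * \<bar>abel (z n) - abel (w n)\<bar>"
      using elim(1) by (intro \<delta>) auto
    then show ?case
      by (simp add: abs_mult)
  qed
  have scale: "(\<lambda>n. 2 * (K / real n)\<^sup>2) \<in> O(\<lambda>n. 1 / real n ^ 2)"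
    using \<open>K > 0\<close> by real_asymp
  have "(\<lambda>n. z n - w n) \<in> O(\<lambda>n. 2 * (K / real n)\<^sup>2 * (abel (z n) - abel (w n)))"
    by (rule landau_o.bigI[of 1]) (use bound in simp_all)
  also have "(\<lambda>n. 2 * (K / real n)\<^sup>2 * (abel (z n) - abel (w n)))
      \<in> o(\<lambda>n. 1 / real n ^ 2 * (1 / real n ^ 5))"
    by (rule landau_o.big_small_mult[OF scale diff])
  also have "(\<lambda>n. 1 / real n ^ 2 * (1 / real n ^ 5)) = (\<lambda>n. 1 / real n ^ 7)"
    by (simp flip: power_add)
  finally show thesis
    by (intro that[of C]) (simp add: w_def s_def eval2_corr)
qed

lemma abel_increment:
  fixes z :: "nat \<Rightarrow> real"
  assumes z: "z \<in> O(\<lambda>n. 1 / real n)" and nz: "\<And>n. z n \<noteq> 0"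
  shows "(\<lambda>n. abel (ell_map (z n)) - abel (z n) - 1) \<in> O(\<lambda>n. 1 / real n ^ 7)"
proof -
  note z
  also have "(\<lambda>n. 1 / real n) \<in> o(\<lambda>n. 1)"
    by real_asymp
  finally have "z \<longlonglongrightarrow> 0"
    using smalloD_tendsto by force
  then have "filterlim z (at 0) sequentially"
    using nz by (simp add: filterlim_at)
  from landau_o.big.compose[OF abel_ell_map this]
  have "(\<lambda>n. abel (ell_map (z n)) - abel (z n) - 1) \<in> O(\<lambda>n. z n ^ 7)" .
  also have "(\<lambda>n. z n ^ 7) \<in> O(\<lambda>n. (1 / real n) ^ 7)"
    by (rule landau_o.big_power[OF z])
  finally show ?thesis
    by (simp add: power_one_over)
qed

lemma reciprocal_growth:
  fixes x :: "nat \<Rightarrow> real"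
  assumes pos: "\<And>n. x n > 0" and "c > 0" and grow: "\<And>n. 1 / x (Suc n) \<ge> 1 / x n + c"
  shows "x \<in> O(\<lambda>n. 1 / real n)"
proof (rule landau_o.bigI)
  have *: "c * real n \<le> 1 / x n" for n
  proof (induction n)
    case 0
    show ?case using pos[of 0] by simp
  next
    case (Suc n)
    then show ?case using grow[of n] by (simp add: algebra_simps)
  qed
  show "\<forall>\<^sub>F n in sequentially. norm (x n) \<le> 1 / c * norm (1 / real n)"
    using eventually_gt_at_top[of 0]
  proof eventually_elim
    case (elim n)
    with *[of n] pos[of n] \<open>c > 0\<close> show ?case
      by (simp add: field_simps)
  qed
qed (use \<open>c > 0\<close> in simp)

text \<open>Here \<open>1 / ell_map x = 1 / x + 1 / (1 - x)\<close>, so reciprocals grow by at least 1.\<close>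

lemma ell_map_orbit_expansion:
  fixes x :: "nat \<Rightarrow> real"
  assumes x0: "0 < x 0" "x 0 < 1" and rec: "\<And>n. x (Suc n) = ell_map (x n)"
  obtains C where "(\<lambda>n. x n - 1 / real n *
      (1 + (\<Sum>m=1..6. poly (P_poly m) (- ln (real n) - C) * (1 / real n ^ m)))) \<in> o(\<lambda>n. 1 / real n ^ 7)"
proof -
  have range: "0 < x n \<and> x n < 1" for n
  proof (induction n)
    case (Suc n)
    then have "x n * (1 - x n) < 1 * 1"
      by (intro mult_strict_mono) auto
    with Suc show ?case
      by (simp add: rec ell_map_def)
  qed (use x0 in simp)
  have "1 / x (Suc n) \<ge> 1 / x n + 1" for n
    using range[of n] by (simp add: rec ell_map_def field_simps)
  then have x: "x \<in> O(\<lambda>n. 1 / real n)"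
    using range by (intro reciprocal_growth[of x 1]) auto
  have "(\<lambda>n. abel (x (Suc n)) - abel (x n) - 1) \<in> O(\<lambda>n. 1 / real n ^ 7)"
    unfolding rec using range by (intro abel_increment x) (metis less_irrefl)
  then show thesis
    using range x by (elim orbit_expansion[of 1 x, rotated 3]) (auto simp: power_one_over intro: that)
qed

lemma r_map_pos_root:
  assumes "x > 0"
  shows "r_map x > 0" "r_map x + (r_map x)\<^sup>2 = x"
proof -
  have "sqrt (1 + 4 * x) > 1"
    using assms by simp
  then show "r_map x > 0"
    by (simp add: r_map_def)
  have "(sqrt (1 + 4 * x))\<^sup>2 = 1 + 4 * x"
    using assms by simp
  then show "r_map x + (r_map x)\<^sup>2 = x"
    by (simp add: r_map_def field_simps power2_eq_square)
qed

text \<open>The sequence \<open>z = - x\<close> is a backward orbit of \<open>ell_map\<close>. Reciprocals of \<open>x\<close> grow by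
  \<open>1 / (1 + x (Suc n))\<close>, which is bounded below because \<open>x\<close> decreases.\<close>

lemma r_map_orbit_expansion:
  fixes x :: "nat \<Rightarrow> real"
  assumes x0: "0 < x 0" and rec: "\<And>n. x (Suc n) = r_map (x n)"
  obtains C where "(\<lambda>n. x n - 1 / real n *
      (1 + (\<Sum>m=1..6. poly (R_poly m) (ln (real n) + C) * (1 / real n ^ m)))) \<in> o(\<lambda>n. 1 / real n ^ 7)"
proof -
  have pos: "0 < x n" for n
    by (induction n) (simp_all add: rec x0 r_map_pos_root)
  have prev: "x n = x (Suc n) + (x (Suc n))\<^sup>2" for n
    using r_map_pos_root(2)[OF pos[of n]] by (simp add: rec)
  have decr: "x (Suc n) \<le> x n" for n
    using prev[of n] by simp
  have le: "x n \<le> x 0" for n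
    by (rule lift_Suc_antimono_le[of x]) (simp_all add: decr)
  have "1 / x (Suc n) \<ge> 1 / x n + 1 / (1 + x 0)" for n
  proof -
    have "1 / x n + 1 / (1 + x (Suc n)) = 1 / x (Suc n)"
    proof -
      have "x n = x (Suc n) * (1 + x (Suc n))"
        using prev[of n] by (simp add: algebra_simps power2_eq_square)
      moreover have "1 / (y * (1 + y)) + 1 / (1 + y) = 1 / y" if "y > 0" for y :: real
        using that by (simp add: divide_simps)
      ultimately show ?thesis
        using pos[of "Suc n"] by simp
    qed
    moreover have "1 / (1 + x 0) \<le> 1 / (1 + x (Suc n))"
      using pos[of "Suc n"] le[of "Suc n"] by (intro divide_left_mono mult_pos_pos) auto
    ultimately show ?thesis
      by linarith
  qed
  then have x: "x \<in> O(\<lambda>n. 1 / real n)"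
    using pos x0 by (intro reciprocal_growth[of x "1 / (1 + x 0)"] divide_pos_pos add_pos_pos) simp_all
  define z where "z n = - x n" for n
  have z: "z \<in> O(\<lambda>n. 1 / real n)"
    using x by (simp add: z_def[abs_def])
  have "(\<lambda>n. x (Suc n)) \<in> O(x)"
    by (rule landau_o.bigI[of 1]) (use decr pos in \<open>auto simp: less_imp_le\<close>)
  also note x
  finally have "(\<lambda>n. z (Suc n)) \<in> O(\<lambda>n. 1 / real n)"
    by (simp add: z_def)
  then have "(\<lambda>n. abel (ell_map (z (Suc n))) - abel (z (Suc n)) - 1) \<in> O(\<lambda>n. 1 / real n ^ 7)"
    by (rule abel_increment) (metis pos z_def less_irrefl neg_equal_0_iff_equal)
  moreover have "ell_map (z (Suc n)) = z n" for n
    using prev[of n] by (simp add: ell_map_def z_def algebra_simps power2_eq_square)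
  ultimately have "(\<lambda>n. abel (z n) - abel (z (Suc n)) - 1) \<in> O(\<lambda>n. 1 / real n ^ 7)"
    by simp
  then have "(\<lambda>n. - (abel (z n) - abel (z (Suc n)) - 1)) \<in> O(\<lambda>n. 1 / real n ^ 7)"
    by (simp only: landau_o.big.uminus_in_iff)
  also have "(\<lambda>n. - (abel (z n) - abel (z (Suc n)) - 1)) = (\<lambda>n. abel (z (Suc n)) - abel (z n) - (-1))"
    by (simp add: algebra_simps)
  finally have step: "(\<lambda>n. abel (z (Suc n)) - abel (z n) - (-1)) \<in> O(\<lambda>n. 1 / real n ^ 7)" .
  obtain C where C: "(\<lambda>n. z n - (-1) / real n *
      (1 + (\<Sum>m=1..6. poly (P_poly m) (- ln (real n) - C) * ((-1) / real n) ^ m))) \<in> o(\<lambda>n. 1 / real n ^ 7)"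
    by (rule orbit_expansion[of "-1" z, OF _ _ z step]) (use pos in \<open>simp_all add: z_def\<close>)
  have "poly (P_poly m) (- ln (real n) - C) * ((-1) / real n) ^ m =
      poly (R_poly m) (ln (real n) + C) * (1 / real n ^ m)" for m n
  proof -
    have "((-1) / real n) ^ m = (-1) ^ m * (1 / real n ^ m)"
      by (simp only: power_divide) simp
    moreover have "- (ln (real n) + C) = - ln (real n) - C"
      by simp
    ultimately show ?thesis
      by (simp only: R_poly_def poly_smult poly_pcompose poly_pCons poly_0) simp
  qed
  then have "(\<lambda>n. - (x n - 1 / real n *
      (1 + (\<Sum>m=1..6. poly (R_poly m) (ln (real n) + C) * (1 / real n ^ m))))) \<in> o(\<lambda>n. 1 / real n ^ 7)"
    using C by (simp add: z_def)
  then show thesis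
    by (intro that[of C]) (simp only: landau_o.small.uminus_in_iff)
qed

theorem mainTheorem1:
  shows
    "(\<forall>(\<epsilon>::real) (x0::real) (x::nat \<Rightarrow> real).
        \<epsilon> > 0 \<longrightarrow>
        (\<forall>t. 0 < t \<and> t < \<epsilon> \<longrightarrow> ell_map t \<noteq> 0 \<and> ell_map t \<noteq> t) \<longrightarrow>
        0 < x0 \<longrightarrow> x0 < \<epsilon> \<longrightarrow>
        x 0 = x0 \<longrightarrow> (\<forall>n\<ge>1. x n = ell_map (x (n - 1))) \<longrightarrow>
        (\<exists>C::real.
          (\<lambda>n. x n - 1 / real n *
                 (1 + (\<Sum>m=1..6. poly (P_poly m) (- ln (real n) - C) * (1 / real n ^ m))))
            \<in> o(\<lambda>n. 1 / real n ^ 7)))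
     \<and>
     (\<forall>(\<epsilon>::real) (x0::real) (x::nat \<Rightarrow> real).
        \<epsilon> > 0 \<longrightarrow>
        (\<forall>t. 0 < t \<and> t < \<epsilon> \<longrightarrow> r_map t \<noteq> 0 \<and> r_map t \<noteq> t) \<longrightarrow>
        0 < x0 \<longrightarrow> x0 < \<epsilon> \<longrightarrow>
        x 0 = x0 \<longrightarrow> (\<forall>n\<ge>1. x n = r_map (x (n - 1))) \<longrightarrow>
        (\<exists>C::real.
          (\<lambda>n. x n - 1 / real n *
                 (1 + (\<Sum>m=1..6. poly (R_poly m) (ln (real n) + C) * (1 / real n ^ m))))
            \<in> o(\<lambda>n. 1 / real n ^ 7)))"
proof (intro conjI allI impI)
  fix \<epsilon> x0 :: real and x :: "nat \<Rightarrow> real"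
  assume fix_free: "\<forall>t. 0 < t \<and> t < \<epsilon> \<longrightarrow> ell_map t \<noteq> 0 \<and> ell_map t \<noteq> t"
    and x: "0 < x0" "x0 < \<epsilon>" "x 0 = x0" "\<forall>n\<ge>1. x n = ell_map (x (n - 1))"
  \<comment> \<open>since \<open>ell_map 1 = 0\<close>\<close>
  have "\<epsilon> \<le> 1"
  proof (rule ccontr)
    assume "\<not> \<epsilon> \<le> 1"
    then have "ell_map 1 \<noteq> 0"
      using fix_free[rule_format, of 1] by simp
    then show False
      by (simp add: ell_map_def)
  qed
  with x have "0 < x 0" "x 0 < 1" "\<And>n. x (Suc n) = ell_map (x n)"
    by auto
  then show "\<exists>C. (\<lambda>n. x n - 1 / real n *
      (1 + (\<Sum>m=1..6. poly (P_poly m) (- ln (real n) - C) * (1 / real n ^ m)))) \<in> o(\<lambda>n. 1 / real n ^ 7)"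
    using ell_map_orbit_expansion by blast
next
  fix x0 :: real and x :: "nat \<Rightarrow> real"
  assume x: "0 < x0" "x 0 = x0" "\<forall>n\<ge>1. x n = r_map (x (n - 1))"
  then have "0 < x 0" "\<And>n. x (Suc n) = r_map (x n)"
    by auto
  then show "\<exists>C. (\<lambda>n. x n - 1 / real n *
      (1 + (\<Sum>m=1..6. poly (R_poly m) (ln (real n) + C) * (1 / real n ^ m)))) \<in> o(\<lambda>n. 1 / real n ^ 7)"
    using r_map_orbit_expansion by blast
qed

end
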